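(* Let $n\ge 1$ and let $\lambda_{\max}(\cdot,\cdot):\mathbb{S}^n_{\succeq0}\times\mathbb{S}^n_{\succeq0}\to(-\infty,\infty]$ be defined by $$\lambda_{\max}(X,Y):=\begin{cases}\displaystyle\sup_{v\in\mathbb{R}^n,\ v\notin\mathrm{Ker}\,Y}\frac{v^\top Xv}{v^\top Yv} & (Y\neq0),\\ \infty & (X\neq0,\ Y=0),\\ 0 & (X=Y=0).\end{cases}$$ Then for all $X,Y\in\mathbb{S}^n_{\succeq0}$, $$\lambda_{\max}(X,Y)=\inf\{\alpha\ge0\mid\alpha Y-X\succeq0\},$$ where the infimum is defined to be $\infty$ if there is no $\alpha\ge0$ with $\alpha Y-X\succeq0$. Consequently, $\lambda_{\max}(\cdot,\cdot)$ is nonnegative, lower semi-continuous, and quasiconvex on $\mathbb{S}^n_{\succeq0}\times\mathbb{S}^n_{\succeq0}$.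
   Context: $\mathbb{S}^n_{\succeq0}$ is the set of real symmetric positive semidefinite $n\times n$ matrices; $A\succeq0$ means that $A$ is symmetric positive semidefinite; $\mathrm{Ker}\,Y=\{v\in\mathbb{R}^n\mid Yv=0\}$. A function $f:D\to(-\infty,\infty]$ on a nonempty convex set $D$ is quasiconvex if $\{x\in D\mid f(x)\le\alpha\}$ is convex for every $\alpha\in\mathbb{R}$. *)

theory Defs
  imports "HOL-Analysis.Analysis"
begin

definition psd :: "real^'n^'n \<Rightarrow> bool"
  where "psd A \<longleftrightarrow> transpose A = A \<and> (\<forall>v. 0 \<le> v \<bullet> (A *v v))"

definition psd_matrices :: "(real^'n^'n) set"
  where "psd_matrices = {A. psd A}"

definition Ker :: "real^'n^'n \<Rightarrow> (real^'n) set"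
  where "Ker A = {v. A *v v = 0}"

text \<open>
  For positive semidefinite \<open>Y\<close>, every \<open>v \<notin> Ker Y\<close> satisfies \<open>v \<bullet> (Y *v v) > 0\<close>, so the quotient
  below is a genuine one; outside \<open>psd_matrices \<times> psd_matrices\<close> the value is of no significance.
\<close>
definition lambda_max :: "real^'n^'n \<Rightarrow> real^'n^'n \<Rightarrow> ereal"
  where "lambda_max X Y =
    (if Y \<noteq> 0 then SUP v \<in> {v. v \<notin> Ker Y}. ereal ((v \<bullet> (X *v v)) / (v \<bullet> (Y *v v)))
     else if X \<noteq> 0 then \<infinity>
     else 0)"

text \<open>
  Lower semicontinuity is taken with respect to the subspace topology of \<open>D\<close>. The filter
  \<open>at x within D\<close> is punctured, but omitting the value at \<open>x\<close> itself does not affect the condition.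
\<close>
definition lower_semicontinuous_on :: "'a::topological_space set \<Rightarrow> ('a \<Rightarrow> ereal) \<Rightarrow> bool"
  where "lower_semicontinuous_on D f \<longleftrightarrow> (\<forall>x\<in>D. f x \<le> Liminf (at x within D) f)"

text \<open>The first three conjuncts express that \<open>f\<close> is a function from a nonempty convex set to
  \<open>(-\<infinity>, \<infinity>]\<close>.\<close>
definition quasiconvex_on :: "'a::real_vector set \<Rightarrow> ('a \<Rightarrow> ereal) \<Rightarrow> bool"
  where "quasiconvex_on D f \<longleftrightarrow>
    D \<noteq> {} \<and> convex D \<and> (\<forall>x\<in>D. -\<infinity> < f x) \<and>
    (\<forall>\<alpha>::real. convex {x \<in> D. f x \<le> ereal \<alpha>})"

end

(* For psd X, Y the sublevel condition "lambda_max X Y <= alpha" is equivalent to "alpha >= 0 and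
   alpha Y - X is psd". On vectors outside Ker Y this is clearing denominators; a vector of Ker Y is
   a limit of vectors outside Ker Y when Y is nonzero. Hence lambda_max is the stated infimum, and
   its sublevel sets are preimages of the closed convex cone of psd matrices under linear maps. *)

theory Submission
  imports Defs
begin

text \<open>Symmetry merges the two cross terms. The resulting polynomial in \<open>t\<close> is
  used twice: to leave a zero of the form downhill, and to approach a kernel vector.\<close>

lemma quadratic_form_add_scaleR:
  fixes A :: "real^'n^'n"
  assumes "transpose A = A"
  shows "(v + t *\<^sub>R w) \<bullet> (A *v (v + t *\<^sub>R w))
    = v \<bullet> (A *v v) + 2 * t * (w \<bullet> (A *v v)) + t\<^sup>2 * (w \<bullet> (A *v w))"
proof -
  have "v \<bullet> (A *v w) = w \<bullet> (A *v v)"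
    by (metis assms dot_lmul_matrix inner_commute vector_transpose_matrix)
  then show ?thesis
    by (simp add: matrix_vector_right_distrib matrix_vector_mult_scaleR inner_add_left
        inner_add_right power2_eq_square algebra_simps)
qed

text \<open>If \<open>A *v v\<close> were nonzero, a small step from \<open>v\<close> against
  \<open>A *v v\<close> would make the form negative: the linear term in the step size dominates the
  quadratic one.\<close>

lemma psd_quadratic_form_eq_0:
  assumes "psd A" and "v \<bullet> (A *v v) = 0"
  shows "A *v v = 0"
proof (rule ccontr)
  assume nz: "A *v v \<noteq> 0"
  define w where "w = A *v v"
  define c where "c = w \<bullet> (A *v w)"
  define N where "N = w \<bullet> w"
  have "N > 0" using nz by (simp add: N_def w_def)
  have "c \<ge> 0" using assms(1) by (simp add: psd_def c_def)
  \<comment> \<open>The parabola \<open>2 * t * N + t\<^sup>2 * c\<close> has its vertex at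
    \<open>- N / c\<close>; the denominator \<open>c + 1\<close> also covers \<open>c = 0\<close>
    and still gives a negative value.\<close>
  define t where "t = - N / (c + 1)"
  have "0 \<le> (v + t *\<^sub>R w) \<bullet> (A *v (v + t *\<^sub>R w))"
    using assms(1) by (simp add: psd_def)
  also have "\<dots> = 2 * t * N + t\<^sup>2 * c"
    using assms by (subst quadratic_form_add_scaleR) (auto simp: psd_def N_def c_def w_def)
  also have "\<dots> = t * (2 * N + t * c)"
    by (simp add: power2_eq_square algebra_simps)
  also have "2 * N + t * c = N * (c + 2) / (c + 1)"
    using \<open>c \<ge> 0\<close> by (simp add: t_def field_simps)
  also have "t * (N * (c + 2) / (c + 1)) < 0"
    using \<open>c \<ge> 0\<close> \<open>N > 0\<close> by (intro mult_neg_pos) (auto simp: t_def)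
  finally show False by simp
qed

text \<open>This makes the denominators in \<open>lambda_max\<close> positive, so that bounds on the
  quotients can be multiplied out.\<close>

lemma psd_quadratic_form_pos:
  assumes "psd Y" and "v \<notin> Ker Y"
  shows "0 < v \<bullet> (Y *v v)"
  using assms psd_quadratic_form_eq_0[of Y v] by (force simp: psd_def Ker_def less_le)

lemma exists_notin_Ker:
  fixes Y :: "real^'n^'n"
  assumes "Y \<noteq> 0"
  obtains w where "w \<notin> Ker Y"
  using assms matrix_eq[of Y 0] by (auto simp: Ker_def)

text \<open>Symmetry is inherited from \<open>X\<close> and \<open>Y\<close>, which leaves only the
  comparison of the two forms.\<close>

lemma psd_scaleR_diff_iff:
  assumes "psd X" and "psd Y"
  shows "psd (\<alpha> *\<^sub>R Y - X) \<longleftrightarrow> (\<forall>v. v \<bullet> (X *v v) \<le> \<alpha> * (v \<bullet> (Y *v v)))"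
proof -
  have "transpose (\<alpha> *\<^sub>R Y - X) = \<alpha> *\<^sub>R transpose Y - transpose X"
    by (simp add: transpose_def vec_eq_iff)
  then show ?thesis
    using assms by (simp add: psd_def matrix_vector_mult_diff_rdistrib scaleR_matrix_vector_assoc[symmetric]
        inner_diff_right)
qed

lemma quadratic_form_le_of_notin_Ker:
  assumes X: "psd X" and Y: "psd Y" and "Y \<noteq> 0"
    and le: "\<And>v. v \<notin> Ker Y \<Longrightarrow> v \<bullet> (X *v v) \<le> \<alpha> * (v \<bullet> (Y *v v))"
  shows "v \<bullet> (X *v v) \<le> \<alpha> * (v \<bullet> (Y *v v))"
proof (cases "v \<in> Ker Y")
  case True
  obtain w where w: "w \<notin> Ker Y"
    using \<open>Y \<noteq> 0\<close> by (rule exists_notin_Ker)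
  \<comment> \<open>The form of \<open>A\<close> along the line \<open>v + s *\<^sub>R w\<close>,
    written as a polynomial in \<open>s\<close> so that its limit at 0 is immediate.\<close>
  define q where
    "q A s = v \<bullet> (A *v v) + 2 * s * (w \<bullet> (A *v v)) + s\<^sup>2 * (w \<bullet> (A *v w))" for A s
  have q: "q A s = (v + s *\<^sub>R w) \<bullet> (A *v (v + s *\<^sub>R w))" if "psd A" for A s
    using that by (simp add: quadratic_form_add_scaleR psd_def q_def)
  \<comment> \<open>Since \<open>Y *v v = 0\<close>, \<open>Y\<close> maps this vector to
    \<open>s *\<^sub>R (Y *v w)\<close>.\<close>
  have "v + s *\<^sub>R w \<notin> Ker Y" if "s \<noteq> 0" for s
    using True w that by (simp add: Ker_def matrix_vector_right_distrib matrix_vector_mult_scaleR)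
  then have "\<forall>\<^sub>F s in at 0. q X s \<le> \<alpha> * q Y s"
    using le X Y by (auto simp: eventually_at_filter q)
  moreover have "(q A \<longlongrightarrow> q A 0) (at 0)" for A
    unfolding q_def by (intro tendsto_intros)
  ultimately have "q X 0 \<le> \<alpha> * q Y 0"
    by (intro tendsto_le[of "at 0" "\<lambda>s. \<alpha> * q Y s" _ "q X"] tendsto_intros) auto
  then show ?thesis by (simp add: q_def)
qed (rule le)

lemma lambda_max_nonneg:
  assumes X: "psd X" and Y: "psd Y"
  shows "0 \<le> lambda_max X Y"
proof (cases "Y = 0")
  case False
  then obtain w where w: "w \<notin> Ker Y"
    by (rule exists_notin_Ker)
  \<comment> \<open>A single nonnegative quotient bounds the supremum from below; without the index
    \<open>w\<close> it could be the empty supremum, minus infinity.\<close>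
  have "0 \<le> ereal ((w \<bullet> (X *v w)) / (w \<bullet> (Y *v w)))"
    using X Y by (simp add: psd_def)
  also have "\<dots> \<le> lambda_max X Y"
    using False w by (auto simp: lambda_max_def intro!: SUP_upper)
  finally show ?thesis .
qed (simp add: lambda_max_def)

lemma lambda_max_le_ereal_iff:
  assumes X: "psd X" and Y: "psd Y"
  shows "lambda_max X Y \<le> ereal \<alpha> \<longleftrightarrow> 0 \<le> \<alpha> \<and> psd (\<alpha> *\<^sub>R Y - X)"
proof (cases "Y = 0")
  case True
  \<comment> \<open>For \<open>Y = 0\<close> the matrix condition is that \<open>- X\<close> is psd.
    Together with \<open>psd X\<close> this makes the form of \<open>X\<close> vanish
    identically.\<close>
  have "X = 0" if "psd (- X)"
  proof -
    have "v \<bullet> (X *v v) = 0" for v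
      using that psd_scaleR_diff_iff[OF X Y, of \<alpha>] X True by (force simp: psd_def intro: antisym)
    then show ?thesis
      using psd_quadratic_form_eq_0[OF X] by (simp add: matrix_eq)
  qed
  then show ?thesis
    using True Y by (auto simp: lambda_max_def)
next
  case False
  have "lambda_max X Y \<le> ereal \<alpha> \<longleftrightarrow>
      (\<forall>v. v \<notin> Ker Y \<longrightarrow> v \<bullet> (X *v v) \<le> \<alpha> * (v \<bullet> (Y *v v)))"
    using False psd_quadratic_form_pos[OF Y]
    by (auto simp: lambda_max_def SUP_le_iff pos_divide_le_eq)
  also have "\<dots> \<longleftrightarrow> psd (\<alpha> *\<^sub>R Y - X)"
    unfolding psd_scaleR_diff_iff[OF X Y]
    using quadratic_form_le_of_notin_Ker[OF X Y False] by blast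
  \<comment> \<open>The conjunct \<open>0 \<le> \<alpha>\<close> follows from the left side, because
    \<open>lambda_max\<close> is nonnegative.\<close>
  finally show ?thesis
    using lambda_max_nonneg[OF X Y] by (metis ereal_less_eq(5) order_trans)
qed

text \<open>Symmetry and, for each fixed \<open>v\<close>, nonnegativity of the form are closed
  conditions, being linear in the entries of \<open>A\<close>.\<close>

lemma closed_psd_matrices: "closed (psd_matrices :: (real^'n^'n) set)"
proof -
  have "closed {A :: real^'n^'n. transpose A = A}"
    unfolding transpose_def by (intro closed_Collect_eq continuous_intros)
  moreover have "closed {A :: real^'n^'n. 0 \<le> v \<bullet> (A *v v)}" for v
    unfolding matrix_vector_mult_def by (intro closed_Collect_le continuous_intros)
  ultimately have "closed ({A :: real^'n^'n. transpose A = A} \<inter> (\<Inter>v. {A. 0 \<le> v \<bullet> (A *v v)}))"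
    by (intro closed_Int closed_INT ballI)
  also have "{A :: real^'n^'n. transpose A = A} \<inter> (\<Inter>v. {A. 0 \<le> v \<bullet> (A *v v)}) = psd_matrices"
    by (auto simp: psd_matrices_def psd_def)
  finally show ?thesis .
qed

lemma zero_psd: "psd 0"
  by (simp add: psd_def transpose_def vec_eq_iff)

lemma convex_psd_matrices: "convex psd_matrices"
proof (rule convexI)
  fix A B :: "real^'n^'n" and u v :: real
  assume "A \<in> psd_matrices" "B \<in> psd_matrices" "0 \<le> u" "0 \<le> v"
  moreover have "transpose (u *\<^sub>R A + v *\<^sub>R B) = u *\<^sub>R transpose A + v *\<^sub>R transpose B"
    by (simp add: transpose_def vec_eq_iff)
  ultimately show "u *\<^sub>R A + v *\<^sub>R B \<in> psd_matrices"
    by (simp add: psd_matrices_def psd_def matrix_vector_mult_add_rdistrib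
        scaleR_matrix_vector_assoc[symmetric] inner_add_right)
qed

text \<open>Negative \<alpha> has to be split off: \<open>X = Y = 0\<close> satisfies the matrix
  condition for every \<alpha>.\<close>

lemma sublevel_lambda_max:
  "{z \<in> psd_matrices \<times> psd_matrices. (\<lambda>(X, Y). lambda_max X Y) z \<le> ereal \<alpha>}
    = (if 0 \<le> \<alpha> then psd_matrices \<times> psd_matrices \<inter> (\<lambda>(X, Y). \<alpha> *\<^sub>R Y - X) -` psd_matrices else {})"
  by (auto simp: psd_matrices_def lambda_max_le_ereal_iff)

lemma closed_sublevel_lambda_max:
  "closed {z \<in> psd_matrices \<times> psd_matrices. (\<lambda>(X, Y). lambda_max X Y) z \<le> ereal \<alpha>}"
  unfolding sublevel_lambda_max unfolding case_prod_unfold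
  by (auto intro!: closed_Int closed_Times closed_psd_matrices closed_vimage continuous_intros)

lemma convex_sublevel_lambda_max:
  "convex {z \<in> psd_matrices \<times> psd_matrices. (\<lambda>(X, Y). lambda_max X Y) z \<le> ereal \<alpha>}"
proof -
  have "linear (\<lambda>(X, Y). \<alpha> *\<^sub>R Y - X)"
    by (auto intro!: linearI simp: algebra_simps)
  then show ?thesis
    unfolding sublevel_lambda_max
    by (auto intro!: convex_Int convex_Times convex_psd_matrices convex_linear_vimage)
qed

lemma lower_semicontinuous_onI_closed_sublevel:
  fixes f :: "'a::topological_space \<Rightarrow> ereal"
  assumes "\<And>\<alpha>. closed {x \<in> D. f x \<le> ereal \<alpha>}"
  shows "lower_semicontinuous_on D f"
  unfolding lower_semicontinuous_on_def le_Liminf_iff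
proof (intro ballI allI impI)
  fix x y
  assume "x \<in> D" "y < f x"
  \<comment> \<open>Closedness is assumed at real levels only, while \<open>y\<close> may be minus
    infinity; a real \<open>c\<close> strictly in between also keeps the final inequality
    strict.\<close>
  then obtain c where c: "y < ereal c" "ereal c < f x"
    using ereal_dense2 by blast
  have "\<forall>\<^sub>F z in nhds x. z \<notin> {x \<in> D. f x \<le> ereal c}"
    using assms[of c] c(2) eventually_nhds_in_open[of "- {x \<in> D. f x \<le> ereal c}" x]
    by (simp only: Compl_iff closed_def mem_Collect_eq not_le[symmetric] simp_thms)
  then show "\<forall>\<^sub>F z in at x within D. y < f z"
    unfolding eventually_at_filter by eventually_elim (use c(1) in auto)
qed

text \<open>Reals are dense in the extended reals; for infinite \<open>a\<close> the set is empty
  and its infimum is infinity. This turns the description of sublevel sets into the infimum formula,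
  infeasible case included.\<close>

lemma ereal_eq_Inf_upper_reals:
  fixes a :: ereal
  shows "a = Inf {ereal \<alpha> |\<alpha>. a \<le> ereal \<alpha>}"
proof (rule antisym)
  show "a \<le> Inf {ereal \<alpha> |\<alpha>. a \<le> ereal \<alpha>}"
    by (auto intro: Inf_greatest)
  show "Inf {ereal \<alpha> |\<alpha>. a \<le> ereal \<alpha>} \<le> a"
  proof (rule dense_ge)
    fix y assume "a < y"
    then obtain c where "a < ereal c" "ereal c < y"
      using ereal_dense2 by blast
    then show "Inf {ereal \<alpha> |\<alpha>. a \<le> ereal \<alpha>} \<le> y"
      by (intro Inf_lower2[of "ereal c"]) auto
  qed
qed

theorem theorem4:
  fixes S :: "(real^'n^'n) set"
  defines "S \<equiv> psd_matrices"
  shows "(\<forall>X\<in>S. \<forall>Y\<in>S.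
            lambda_max X Y = Inf {ereal \<alpha> |\<alpha>. 0 \<le> \<alpha> \<and> psd (\<alpha> *\<^sub>R Y - X)}) \<and>
         (\<forall>X\<in>S. \<forall>Y\<in>S. 0 \<le> lambda_max X Y) \<and>
         lower_semicontinuous_on (S \<times> S) (\<lambda>(X, Y). lambda_max X Y) \<and>
         quasiconvex_on (S \<times> S) (\<lambda>(X, Y). lambda_max X Y)"
proof (intro conjI ballI)
  fix X Y assume "X \<in> S" "Y \<in> S"
  then have XY: "psd X" "psd Y" by (simp_all add: S_def psd_matrices_def)
  show "lambda_max X Y = Inf {ereal \<alpha> |\<alpha>. 0 \<le> \<alpha> \<and> psd (\<alpha> *\<^sub>R Y - X)}"
    using ereal_eq_Inf_upper_reals[of "lambda_max X Y"] by (simp only: lambda_max_le_ereal_iff[OF XY])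
  show "0 \<le> lambda_max X Y"
    by (rule lambda_max_nonneg[OF XY])
next
  show "lower_semicontinuous_on (S \<times> S) (\<lambda>(X, Y). lambda_max X Y)"
    unfolding S_def by (intro lower_semicontinuous_onI_closed_sublevel closed_sublevel_lambda_max)
next
  have "- \<infinity> < lambda_max X Y" if "X \<in> S" "Y \<in> S" for X Y
    using lambda_max_nonneg[of X Y] that by (auto simp: S_def psd_matrices_def intro: less_le_trans[of _ 0])
  moreover have "(0, 0) \<in> S \<times> S"
    by (simp add: S_def psd_matrices_def zero_psd)
  ultimately show "quasiconvex_on (S \<times> S) (\<lambda>(X, Y). lambda_max X Y)"
    unfolding quasiconvex_on_def S_def
    using convex_sublevel_lambda_max by (auto intro: convex_Times convex_psd_matrices)
qed

end
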